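(* Let $n\ge 2$ and let $N_n$ denote the number of trees of the Moran forest $\mathscr{F}_n$. The probability mass function of $N_n$ is \[ \mathbb{P}(N_n = k) = \frac{a(n-1,k-1)}{(n-1)^{n-2}}, \] where $a(n,k)$ denotes the number of rooted labeled trees on $\{1,\ldots,n\}$ with exactly $k$ increasing edges.
   Context: In a rooted tree on $\{1,\ldots,n\}$, edges are oriented away from the root; an edge $\vec{uv}$ pointing away from the root is said to be increasing if $u<v$. Moran forest: for fixed $n\ge 2$, consider the Markov chain on directed graphs on $\{1,\ldots,n\}$ whose transitions are: at each time-step, choose an ordered pair of distinct vertices $(u,v)$ uniformly at random; disconnect $v$ from all of its neighbors (remove all edges incident to $v$), then add the edge $\vec{uv}$. This chain has a unique stationary distribution, whose support is the set of non-empty rooted forests (those with at least one edge) on $\{1,\ldots,n\}$. The Moran forest $\mathscr{F}_n$ is a random forest having this stationary distribution. The trees of the forest are its connected components (isolated vertices count as trees). *)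

theory Defs
  imports "HOL-Probability.Probability"
begin

section \<open>The Moran forest\<close>

text \<open>A directed graph on \<open>{1..n}\<close> is represented by its set of edges; the pair \<open>(u, v)\<close> is the
  edge from \<open>u\<close> to \<open>v\<close>. There are no loops.\<close>

definition ordered_pairs :: "nat \<Rightarrow> (nat \<times> nat) set" where
  "ordered_pairs n = {(u, v). u \<in> {1..n} \<and> v \<in> {1..n} \<and> u \<noteq> v}"

definition digraphs :: "nat \<Rightarrow> (nat \<times> nat) set set" where
  "digraphs n = Pow (ordered_pairs n)"

definition isolate :: "nat \<Rightarrow> (nat \<times> nat) set \<Rightarrow> (nat \<times> nat) set" where
  "isolate v G = {e \<in> G. fst e \<noteq> v \<and> snd e \<noteq> v}"

definition moran_step :: "nat \<Rightarrow> (nat \<times> nat) set \<Rightarrow> (nat \<times> nat) set pmf" where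
  "moran_step n G = map_pmf (\<lambda>(u, v). insert (u, v) (isolate v G)) (pmf_of_set (ordered_pairs n))"

definition moran_stationary :: "nat \<Rightarrow> (nat \<times> nat) set pmf \<Rightarrow> bool" where
  "moran_stationary n p \<longleftrightarrow> set_pmf p \<subseteq> digraphs n \<and> bind_pmf p (moran_step n) = p"

text \<open>The law of the Moran forest. For \<open>n \<ge> 2\<close> the chain has exactly one stationary distribution
  on the directed graphs on \<open>{1..n}\<close>; for \<open>n < 2\<close> there is no pair to choose from and the value
  is irrelevant.\<close>

definition moran_forest :: "nat \<Rightarrow> (nat \<times> nat) set pmf" where
  "moran_forest n = (THE p. moran_stationary n p)"

text \<open>The vertex sets of the connected components of the underlying undirected graph. Isolated
  vertices are included because the reflexive closure is taken before restricting to \<open>{1..n}\<close>.\<close>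

definition components_of_graph :: "nat \<Rightarrow> (nat \<times> nat) set \<Rightarrow> nat set set" where
  "components_of_graph n G = {1..n} // ((G \<union> G\<inverse>)\<^sup>* \<inter> {1..n} \<times> {1..n})"

definition num_trees :: "nat \<Rightarrow> (nat \<times> nat) set \<Rightarrow> nat" where
  "num_trees n G = card (components_of_graph n G)"


section \<open>Rooted labeled trees and increasing edges\<close>

definition walk_from_to :: "('a \<times> 'a) set \<Rightarrow> 'a \<Rightarrow> 'a \<Rightarrow> 'a list \<Rightarrow> bool" where
  "walk_from_to E x y xs \<longleftrightarrow>
     xs \<noteq> [] \<and> hd xs = x \<and> last xs = y \<and> successively (\<lambda>a b. (a, b) \<in> E) xs"

text \<open>A tree on \<open>V\<close> with root \<open>r\<close>, given by its edges oriented away from the root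
  (an arborescence): from \<open>r\<close> there is exactly one directed walk to each vertex.\<close>

definition rooted_tree :: "'a set \<Rightarrow> 'a \<Rightarrow> ('a \<times> 'a) set \<Rightarrow> bool" where
  "rooted_tree V r E \<longleftrightarrow>
     r \<in> V \<and> E \<subseteq> V \<times> V \<and> (\<forall>v\<in>V. \<exists>!xs. walk_from_to E r v xs)"

definition increasing_edges :: "(nat \<times> nat) set \<Rightarrow> (nat \<times> nat) set" where
  "increasing_edges E = {(u, v) \<in> E. u < v}"

text \<open>The number of rooted labeled trees on \<open>{1..n}\<close> with exactly \<open>k\<close> increasing edges. The
  argument \<open>k\<close> is an integer, so that \<open>num_inc_rooted_trees n (-1) = 0\<close>.\<close>

definition num_inc_rooted_trees :: "nat \<Rightarrow> int \<Rightarrow> nat" where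
  "num_inc_rooted_trees n k = card {(r, E). rooted_tree {1..n} r E \<and> int (card (increasing_edges E)) = k}"

end

theory Submission
  imports Defs
begin

text \<open>
  Both sides are coefficients of explicit products of linear factors. With \<open>m = n - 1\<close>, the product on
  each side is, up to normalisation, \<open>x * (\<Prod>j=1..<m. j + (m - j) * x)\<close>.

  \<^bold>\<open>The law of the Moran forest.\<close> Let \<open>S\<close> be a set of vertices. The graph induced on \<open>S\<close> changes only
  when a vertex \<open>v \<in> S\<close> moves, and after such a move it consists of the graph induced on \<open>S - {v}\<close>
  and of the edge \<open>(u, v)\<close> if \<open>u \<in> S\<close>. Under a stationary law, the law of the graph induced on \<open>S\<close> is
  therefore the average, over \<open>v \<in> S\<close> and \<open>u \<noteq> v\<close>, of the laws obtained by attaching \<open>v\<close> to the graph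
  induced on \<open>S - {v}\<close> (\<open>stationary_induced\<close>). This recursion on the size of \<open>S\<close> determines the
  stationary law. Conversely, the laws that the recursion defines are consistent under restriction
  (\<open>expectation_induced_attachment_law\<close>), and so the one for \<open>S = {1..n}\<close> is stationary.

  Along the recursion, a vertex that joins \<open>i\<close> others is attached to one of them with probability
  \<open>i / (n - 1)\<close>, independently of the past, and stays isolated otherwise. In the first case the number
  of trees stays the same and in the second it grows by one, so its generating function is
  \<open>\<Prod>i<n. (i + (n - 1 - i) * x) / (n - 1)\<close>.

  \<^bold>\<open>Increasing edges.\<close> Trees are counted through forests, with \<open>x\<close> marking increasing edges and \<open>y\<close> the
  roots other than one of them. Add a new largest vertex to a forest on \<open>{1..m}\<close> by choosing its
  parent and which roots become its children. The choice of the children replaces \<open>y\<close> by \<open>1 + y\<close>, and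
  the choice of the parent gives the factor \<open>1 + y + m * x\<close>. Iterating, the generating function of
  forests is \<open>\<Prod>j=1..<m. y + j + (m - j) * x\<close> (\<open>parent_maps_generating_function\<close>); trees correspond
  to \<open>y = 0\<close>.
\<close>

section \<open>Forests by increasing edges\<close>

text \<open>Forests are encoded by parent maps \<open>f :: nat \<Rightarrow> nat\<close>, where \<open>0\<close> is a virtual vertex above all the
  roots. The predicate says that the path from \<open>v\<close> up to \<open>0\<close> exists and avoids \<open>C\<close>. With \<open>C = {}\<close> it
  expresses acyclicity; a nonempty \<open>C\<close> is used to say that \<open>v\<close> does not lie in a tree with root
  in \<open>C\<close>.\<close>

inductive reaches :: "(nat \<Rightarrow> nat) \<Rightarrow> nat set \<Rightarrow> nat \<Rightarrow> bool" for f C where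
  zero: "reaches f C 0"
| step: "v \<notin> C \<Longrightarrow> reaches f C (f v) \<Longrightarrow> reaches f C v"

lemma reaches_iff: "reaches f C v \<longleftrightarrow> v = 0 \<or> (v \<notin> C \<and> reaches f C (f v))"
  by (meson reaches.cases reaches.intros)

lemma not_reaches_if_closed:
  assumes "reaches f C v" and "\<And>a. a \<in> A \<Longrightarrow> f a \<in> A" and "0 \<notin> A"
  shows "v \<notin> A"
  using assms(1) by induction (use assms(2,3) in auto)

definition parent_maps :: "nat \<Rightarrow> (nat \<Rightarrow> nat) set" where
  "parent_maps m = {f. (\<forall>v. f v \<le> m) \<and> (\<forall>v. v \<notin> {1..m} \<longrightarrow> f v = 0) \<and> (\<forall>v. reaches f {} v)}"

definition roots :: "nat \<Rightarrow> (nat \<Rightarrow> nat) \<Rightarrow> nat set" where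
  "roots m f = {v \<in> {1..m}. f v = 0}"

definition ascents :: "nat \<Rightarrow> (nat \<Rightarrow> nat) \<Rightarrow> nat set" where
  "ascents m f = {v \<in> {1..m}. f v \<noteq> 0 \<and> f v < v}"

lemma finite_roots [simp]: "finite (roots m f)"
  by (simp add: roots_def)

lemma finite_ascents [simp]: "finite (ascents m f)"
  by (simp add: ascents_def)

lemma finite_parent_maps [simp]: "finite (parent_maps m)"
proof (rule finite_subset)
  show "parent_maps m \<subseteq> {f. \<forall>v. (v \<in> {1..m} \<longrightarrow> f v \<in> {..m}) \<and> (v \<notin> {1..m} \<longrightarrow> f v = 0)}"
    by (auto simp: parent_maps_def)
qed (intro finite_set_of_finite_funs; simp)

text \<open>Following the parents of \<open>p\<close> one meets exactly one root, so a set of roots is avoided as soon as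
  it does not contain that one.\<close>

lemma unique_root_above:
  assumes g: "g \<in> parent_maps m" and p: "p \<in> {1..m}"
  shows "\<exists>r\<in>roots m g. \<forall>C\<subseteq>roots m g. reaches g C p \<longleftrightarrow> r \<notin> C"
proof -
  have "reaches g {} p"
    using g by (simp add: parent_maps_def)
  thus ?thesis
    using p
  proof induction
    case zero
    thus ?case by simp
  next
    case (step v)
    show ?case
    proof (cases "g v = 0")
      case True
      hence "v \<in> roots m g"
        using step.prems by (simp add: roots_def)
      moreover have "reaches g C v \<longleftrightarrow> v \<notin> C" for C
        using True step.prems reaches_iff[of g C v] reaches.zero[of g C] by auto
      ultimately show ?thesis by blast
    next
      case False
      hence "g v \<in> {1..m}"
        using g by (auto simp: parent_maps_def)
      with step.IH obtain r where r: "r \<in> roots m g" "\<forall>C\<subseteq>roots m g. reaches g C (g v) \<longleftrightarrow> r \<notin> C"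
        by blast
      have "reaches g C v \<longleftrightarrow> reaches g C (g v)" if "C \<subseteq> roots m g" for C
        using that False step.prems reaches_iff[of g C v] by (auto simp: roots_def)
      with r show ?thesis by blast
    qed
  qed
qed

text \<open>The enumeration of forests works by adding or deleting the largest vertex \<open>Suc m\<close>. Adding it
  means choosing its parent \<open>p\<close> (with \<open>p = 0\<close> if it becomes a root) and the set \<open>C\<close> of its children,
  which were roots before.\<close>

definition add_max :: "nat \<Rightarrow> (nat \<Rightarrow> nat) \<times> nat \<times> nat set \<Rightarrow> nat \<Rightarrow> nat" where
  "add_max m = (\<lambda>(g, p, C) v. if v = Suc m then p else if v \<in> C then Suc m else g v)"

text \<open>The choice \<open>(p, C)\<close> creates a cycle exactly if \<open>p\<close> lies in one of the trees that are hung below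
  \<open>Suc m\<close>, which is why the path from \<open>p\<close> has to avoid \<open>C\<close>.\<close>

definition max_neighbours :: "nat \<Rightarrow> (nat \<Rightarrow> nat) \<Rightarrow> (nat \<times> nat set) set" where
  "max_neighbours m g = (SIGMA p:{..m}. {C. C \<subseteq> roots m g \<and> reaches g C p})"

lemma add_max_in_parent_maps:
  assumes g: "g \<in> parent_maps m" and pC: "(p, C) \<in> max_neighbours m g"
  shows "add_max m (g, p, C) \<in> parent_maps (Suc m)"
proof -
  let ?f = "add_max m (g, p, C)"
  have le: "g v \<le> m" and out: "v \<notin> {1..m} \<Longrightarrow> g v = 0" and nil: "reaches g {} v" for v
    using g by (auto simp: parent_maps_def)
  have p: "p \<le> m" "reaches g C p" and C: "C \<subseteq> roots m g"
    using pC by (auto simp: max_neighbours_def)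
  have "reaches ?f {} a" if "reaches g C a" "a \<le> m" for a
    using that
  proof induction
    case (step v)
    have "?f v = g v"
      using step.hyps step.prems by (simp add: add_max_def)
    thus ?case
      using step.IH le by (metis empty_iff reaches.step)
  qed (rule reaches.zero)
  hence max: "reaches ?f {} (Suc m)"
    using p by (subst reaches_iff) (simp add: add_max_def)
  have "reaches ?f {} v" for v
    using nil[of v]
  proof induction
    case (step v)
    show ?case
    proof (cases "v = Suc m")
      case False
      hence "?f v = Suc m \<or> ?f v = g v"
        by (simp add: add_max_def)
      thus ?thesis
        using max step.IH by (metis empty_iff reaches.step)
    qed (use max in simp)
  qed (rule reaches.zero)
  moreover have "?f v \<le> Suc m" for v
    using le[of v] p(1) by (auto simp: add_max_def)
  moreover have "?f v = 0" if "v \<notin> {1..Suc m}" for v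
    using that out[of v] C by (auto simp: add_max_def roots_def)
  ultimately show ?thesis
    unfolding parent_maps_def by blast
qed

definition delete_max :: "nat \<Rightarrow> (nat \<Rightarrow> nat) \<Rightarrow> nat \<Rightarrow> nat" where
  "delete_max m f v = (if v = Suc m \<or> f v = Suc m then 0 else f v)"

text \<open>Deleting the largest vertex turns its children into roots. The path from its parent cannot meet
  such a child: otherwise the vertices whose path meets \<open>C\<close>, together with \<open>Suc m\<close>, would be closed
  under taking parents and never lead to \<open>0\<close>.\<close>

lemma delete_max:
  assumes f: "f \<in> parent_maps (Suc m)"
  defines "g \<equiv> delete_max m f" and "C \<equiv> {v. f v = Suc m}"
  shows "g \<in> parent_maps m" and "(f (Suc m), C) \<in> max_neighbours m g"
    and "add_max m (g, f (Suc m), C) = f"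
proof -
  have le: "f v \<le> Suc m" and out: "v \<notin> {1..Suc m} \<Longrightarrow> f v = 0" and nil: "reaches f {} v" for v
    using f by (auto simp: parent_maps_def)
  have noloop: "f (Suc m) \<noteq> Suc m"
    using not_reaches_if_closed[OF nil, of "{Suc m}" "Suc m"] by auto
  have gle: "g v \<le> m" for v
    using le[of v] by (auto simp: g_def delete_max_def)
  have "reaches g {} v" for v
    using nil[of v]
  proof induction
    case (step v)
    have "g v = 0 \<or> g v = f v"
      by (auto simp: g_def delete_max_def)
    thus ?case
      using step.IH by (metis empty_iff reaches.step reaches.zero)
  qed (rule reaches.zero)
  moreover have "g v = 0" if "v \<notin> {1..m}" for v
    using that out[of v] by (cases "v = Suc m") (auto simp: g_def delete_max_def)
  ultimately show "g \<in> parent_maps m"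
    using gle unfolding parent_maps_def by blast
  have C: "C \<subseteq> roots m g"
  proof
    fix v assume "v \<in> C"
    hence v: "f v = Suc m" by (simp add: C_def)
    hence "v \<in> {1..Suc m}" "v \<noteq> Suc m"
      using out[of v] noloop by force+
    thus "v \<in> roots m g"
      using v by (auto simp: roots_def g_def delete_max_def)
  qed
  have "reaches g C (f (Suc m))"
  proof (rule ccontr)
    assume not: "\<not> reaches g C (f (Suc m))"
    \<comment> \<open>The vertices from which the path in \<open>g\<close> runs into \<open>C\<close>, and thus the path in \<open>f\<close> into \<open>Suc m\<close>.\<close>
    define A where "A = insert (Suc m) {v. v \<le> m \<and> \<not> reaches g C v}"
    have "f v \<in> A" if v: "v \<in> A" for v
    proof (cases "v = Suc m \<or> v \<in> C")
      case True
      thus ?thesis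
        using not le[of "Suc m"] noloop by (auto simp: A_def C_def)
    next
      case False
      hence "f v = g v" "v \<le> m"
        using v by (auto simp: g_def delete_max_def C_def A_def)
      moreover have "\<not> reaches g C (g v)"
        using v False by (auto simp: A_def intro: reaches.step)
      ultimately show ?thesis
        using gle[of v] by (simp add: A_def)
    qed
    moreover have "0 \<notin> A"
      by (auto simp: A_def intro: reaches.zero)
    ultimately have "Suc m \<notin> A"
      using not_reaches_if_closed[OF nil] by blast
    thus False by (simp add: A_def)
  qed
  thus "(f (Suc m), C) \<in> max_neighbours m g"
    using C le[of "Suc m"] noloop by (auto simp: max_neighbours_def)
  show "add_max m (g, f (Suc m), C) = f"
    by (auto simp: add_max_def g_def delete_max_def C_def fun_eq_iff)
qed

lemma bij_betw_add_max:
  "bij_betw (add_max m) (SIGMA g:parent_maps m. max_neighbours m g) (parent_maps (Suc m))"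
proof (rule bij_betw_byWitness)
  let ?inv = "\<lambda>f. (delete_max m f, f (Suc m), {v. f v = Suc m})"
  show "\<forall>a\<in>SIGMA g:parent_maps m. max_neighbours m g. ?inv (add_max m a) = a"
  proof
    fix a assume "a \<in> (SIGMA g:parent_maps m. max_neighbours m g)"
    then obtain g p C where a: "a = (g, p, C)"
      and g: "g \<in> parent_maps m" and pC: "(p, C) \<in> max_neighbours m g"
      by auto
    have le: "g v \<noteq> Suc m" and out: "v \<notin> {1..m} \<Longrightarrow> g v = 0" for v
      using g by (auto simp: parent_maps_def dest: spec[of _ v])
    have p: "p \<noteq> Suc m" and C: "C \<subseteq> roots m g"
      using pC by (auto simp: max_neighbours_def)
    have "{v. add_max m (g, p, C) v = Suc m} = C"
      using le p C by (auto simp: add_max_def roots_def)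
    moreover have "delete_max m (add_max m (g, p, C)) = g"
      using le p C out by (auto simp: add_max_def delete_max_def roots_def fun_eq_iff)
    ultimately show "?inv (add_max m a) = a"
      unfolding a by (simp add: add_max_def)
  qed
qed (use delete_max add_max_in_parent_maps in auto)

lemma roots_add_max:
  assumes "C \<subseteq> roots m g"
  shows "roots (Suc m) (add_max m (g, p, C)) =
    (if p = 0 then insert (Suc m) (roots m g - C) else roots m g - C)"
  using assms by (auto simp: roots_def add_max_def)

text \<open>As \<open>Suc m\<close> is the largest vertex, the edge into it is increasing and the edges out of it are not.\<close>

lemma ascents_add_max:
  assumes "C \<subseteq> roots m g" "p \<le> m"
  shows "ascents (Suc m) (add_max m (g, p, C)) =
    (if p = 0 then ascents m g else insert (Suc m) (ascents m g))"
  using assms by (auto simp: roots_def ascents_def add_max_def)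

lemma sum_power_card_Diff:
  fixes y :: "'a :: comm_ring_1"
  assumes "finite R"
  shows "(\<Sum>C\<in>Pow R. y ^ card (R - C)) = (1 + y) ^ card R"
  using prod_add[OF assms, of "\<lambda>_. 1" "\<lambda>_. y"] by simp

text \<open>Let \<open>g\<close> have \<open>t\<close> roots. If \<open>Suc m\<close> becomes a root, each of the \<open>t\<close> old roots independently either stays a root or becomes
  a child of \<open>Suc m\<close>, which gives \<open>(1 + y) ^ t\<close>. If it gets one of the \<open>m\<close> old vertices as parent, the
  edge contributes \<open>x\<close>, the root above that parent has to stay a root, and only the other \<open>t - 1\<close>
  roots have a choice.\<close>

lemma sum_max_neighbours:
  fixes x y :: "'a :: comm_ring_1"
  assumes g: "g \<in> parent_maps m" and m: "m \<ge> 1"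
  defines "w \<equiv> \<lambda>f. y ^ (card (roots (Suc m) f) - 1) * x ^ card (ascents (Suc m) f)"
  shows "(\<Sum>(p, C)\<in>max_neighbours m g. w (add_max m (g, p, C))) =
    (1 + y + of_nat m * x) * ((1 + y) ^ (card (roots m g) - 1) * x ^ card (ascents m g))"
proof -
  let ?R = "roots m g" and ?a = "card (ascents m g)"
  let ?Cs = "\<lambda>p. {C. C \<subseteq> ?R \<and> reaches g C p}"
  have fin: "finite (?Cs p)" for p
    by (rule finite_subset[of _ "Pow ?R"]) auto
  have pos: "card ?R \<ge> 1"
    using unique_root_above[OF g, of 1] m by (auto simp: Suc_le_eq card_gt_0_iff)
  have notin: "Suc m \<notin> ?R" "Suc m \<notin> ascents m g"
    by (auto simp: roots_def ascents_def)
  have zero: "(\<Sum>C\<in>?Cs 0. w (add_max m (g, 0, C))) = (1 + y) ^ card ?R * x ^ ?a"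
  proof -
    have "(\<Sum>C\<in>?Cs 0. w (add_max m (g, 0, C))) = (\<Sum>C\<in>Pow ?R. y ^ card (?R - C) * x ^ ?a)"
      using notin by (intro sum.cong) (auto simp: w_def roots_add_max ascents_add_max intro: reaches.zero)
    thus ?thesis
      by (simp add: sum_power_card_Diff flip: sum_distrib_right)
  qed
  have nonzero: "(\<Sum>C\<in>?Cs p. w (add_max m (g, p, C))) = (1 + y) ^ (card ?R - 1) * (x * x ^ ?a)"
    if p: "p \<in> {1..m}" for p
  proof -
    obtain r where r: "r \<in> ?R" "\<forall>C\<subseteq>?R. reaches g C p \<longleftrightarrow> r \<notin> C"
      using unique_root_above[OF g p] by blast
    have Cs: "?Cs p = Pow (?R - {r})"
      using r by auto
    have "(\<Sum>C\<in>?Cs p. w (add_max m (g, p, C))) =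
        (\<Sum>C\<in>Pow (?R - {r}). y ^ card ((?R - {r}) - C) * (x * x ^ ?a))"
      unfolding Cs
    proof (intro sum.cong refl)
      fix C assume C: "C \<in> Pow (?R - {r})"
      hence "?R - C = insert r (?R - {r} - C)" "r \<notin> ?R - {r} - C"
        using r(1) by auto
      hence "card (?R - C) - 1 = card (?R - {r} - C)"
        by simp
      thus "w (add_max m (g, p, C)) = y ^ card (?R - {r} - C) * (x * x ^ ?a)"
        using C p notin by (subst w_def) (simp add: roots_add_max ascents_add_max subset_iff)
    qed
    also have "\<dots> = (1 + y) ^ card (?R - {r}) * (x * x ^ ?a)"
      by (simp only: sum_power_card_Diff flip: sum_distrib_right) (simp add: sum_power_card_Diff)
    finally show ?thesis
      using r(1) by simp
  qed
  have "(\<Sum>(p, C)\<in>max_neighbours m g. w (add_max m (g, p, C))) =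
      (\<Sum>p\<le>m. \<Sum>C\<in>?Cs p. w (add_max m (g, p, C)))"
    unfolding max_neighbours_def using fin by (subst sum.Sigma) auto
  also have "{..m} = insert 0 {1..m}"
    by auto
  also have "(\<Sum>p\<in>\<dots>. \<Sum>C\<in>?Cs p. w (add_max m (g, p, C))) =
      (1 + y) ^ card ?R * x ^ ?a + of_nat m * ((1 + y) ^ (card ?R - 1) * (x * x ^ ?a))"
    using zero nonzero by (subst sum.insert) auto
  also have "(1 + y) ^ card ?R = (1 + y) * (1 + y) ^ (card ?R - 1)"
    using pos by (metis Suc_diff_1 Suc_le_eq One_nat_def power_Suc)
  finally show ?thesis
    by (simp add: algebra_simps)
qed

text \<open>Write \<open>H m y\<close> for the left-hand side. Adding the largest vertex yields
  \<open>H (Suc m) y = (1 + y + m * x) * H m (1 + y)\<close>: the choice of children replaces \<open>y\<close> by \<open>1 + y\<close>. The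
  variable \<open>y\<close> has to be kept for this induction although only \<open>y = 0\<close> concerns trees. The exponent
  is the number of roots minus one so that the recursion needs no division.\<close>

theorem parent_maps_generating_function:
  fixes x y :: "'a :: comm_ring_1"
  assumes "m \<ge> 1"
  shows "(\<Sum>f\<in>parent_maps m. y ^ (card (roots m f) - 1) * x ^ card (ascents m f)) =
    (\<Prod>j=1..<m. y + of_nat j + of_nat (m - j) * x)"
  using assms
proof (induction m arbitrary: y rule: nat_induct_at_least)
  case base
  have "parent_maps 1 = {\<lambda>_. 0}"
  proof (intro equalityI subsetI)
    fix f assume f: "f \<in> parent_maps 1"
    hence nil: "reaches f {} v" and le: "f v \<le> 1" and out: "v \<noteq> 1 \<Longrightarrow> f v = 0" for v
      by (auto simp: parent_maps_def)
    have "f 1 \<noteq> 1"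
      using not_reaches_if_closed[OF nil, of "{1}" 1] by auto
    with le[of 1] out have "f v = 0" for v
      by (cases "v = 1") auto
    thus "f \<in> {\<lambda>_. 0}" by auto
  next
    fix f :: "nat \<Rightarrow> nat" assume "f \<in> {\<lambda>_. 0}"
    thus "f \<in> parent_maps 1"
      by (auto simp: parent_maps_def intro: reaches.intros)
  qed
  moreover have "roots 1 (\<lambda>_. 0) = {1}" "ascents 1 (\<lambda>_. 0) = {}"
    by (auto simp: roots_def ascents_def)
  ultimately show ?case by simp
next
  case (Suc m)
  let ?w = "\<lambda>f. y ^ (card (roots (Suc m) f) - 1) * x ^ card (ascents (Suc m) f)"
  have fin: "finite (max_neighbours m g)" for g
    by (rule finite_subset[of _ "{..m} \<times> Pow (roots m g)"]) (auto simp: max_neighbours_def)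
  have "(\<Sum>f\<in>parent_maps (Suc m). ?w f) =
      (\<Sum>a\<in>(SIGMA g:parent_maps m. max_neighbours m g). ?w (add_max m a))"
    by (rule sum.reindex_bij_betw[OF bij_betw_add_max, symmetric])
  also have "\<dots> = (\<Sum>g\<in>parent_maps m. \<Sum>(p, C)\<in>max_neighbours m g. ?w (add_max m (g, p, C)))"
    using fin by (subst sum.Sigma) (auto simp: case_prod_unfold)
  also have "\<dots> = (1 + y + of_nat m * x) *
      (\<Sum>g\<in>parent_maps m. (1 + y) ^ (card (roots m g) - 1) * x ^ card (ascents m g))"
    unfolding sum_distrib_left using Suc.hyps by (intro sum.cong refl sum_max_neighbours)
  also have "\<dots> = (1 + y + of_nat m * x) * (\<Prod>j=1..<m. 1 + y + of_nat j + of_nat (m - j) * x)"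
    by (simp only: Suc.IH)
  also have "\<dots> = (\<Prod>j=0..<m. y + of_nat (Suc j) + of_nat (Suc m - Suc j) * x)"
    using Suc.hyps by (subst (2) prod.atLeast_Suc_lessThan) (auto simp: algebra_simps)
  also have "\<dots> = (\<Prod>j=1..<Suc m. y + of_nat j + of_nat (Suc m - j) * x)"
    by (simp only: prod.shift_bounds_Suc_ivl One_nat_def)
  finally show ?case .
qed

definition tree_maps :: "nat \<Rightarrow> (nat \<Rightarrow> nat) set" where
  "tree_maps m = {f \<in> parent_maps m. card (roots m f) = 1}"

text \<open>Setting \<open>y = 0\<close> selects the forests with a single root, because \<open>0 ^ 0 = 1\<close>.\<close>

corollary tree_maps_generating_function:
  fixes x :: "'a :: comm_ring_1"
  assumes "m \<ge> 1"
  shows "(\<Sum>f\<in>tree_maps m. x ^ card (ascents m f)) =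
    (\<Prod>j=1..<m. of_nat j + of_nat (m - j) * x)"
proof -
  have one: "card (roots m f) - 1 = 0 \<longleftrightarrow> card (roots m f) = 1" if "f \<in> parent_maps m" for f
    using unique_root_above[OF that, of 1] assms card_gt_0_iff[of "roots m f"] by fastforce
  have "(\<Sum>f\<in>tree_maps m. x ^ card (ascents m f)) =
    (\<Sum>f\<in>parent_maps m. if card (roots m f) = 1 then x ^ card (ascents m f) else 0)"
    by (simp add: tree_maps_def sum.inter_filter)
  also have "\<dots> = (\<Sum>f\<in>parent_maps m. 0 ^ (card (roots m f) - 1) * x ^ card (ascents m f))"
    using one by (intro sum.cong) (auto simp: power_0_left)
  finally show ?thesis
    using parent_maps_generating_function[OF assms, of 0 x] by simp
qed

section \<open>Rooted trees as parent maps\<close>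

lemma walk_snocI:
  assumes "walk_from_to E r u xs" "(u, v) \<in> E"
  shows "walk_from_to E r v (xs @ [v])"
  using assms by (auto simp: walk_from_to_def successively_append_iff)

lemma walk_snocD:
  assumes "walk_from_to E r v xs"
  shows "(xs = [r] \<and> v = r) \<or> (\<exists>u ys. xs = ys @ [v] \<and> walk_from_to E r u ys \<and> (u, v) \<in> E)"
proof (cases xs rule: rev_cases)
  case (snoc ys a)
  hence [simp]: "a = v"
    using assms by (simp add: walk_from_to_def)
  show ?thesis
  proof (cases "ys = []")
    case False
    hence "walk_from_to E r (last ys) ys" "(last ys, v) \<in> E"
      using assms snoc by (auto simp: walk_from_to_def successively_append_iff)
    thus ?thesis
      using snoc by auto
  qed (use assms snoc in \<open>auto simp: walk_from_to_def\<close>)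
qed (use assms in \<open>simp add: walk_from_to_def\<close>)

definition map_edges :: "nat \<Rightarrow> (nat \<Rightarrow> nat) \<Rightarrow> (nat \<times> nat) set" where
  "map_edges m f = {(u, v). v \<in> {1..m} \<and> u = f v \<and> u \<noteq> 0}"

text \<open>In the edge set of a parent map every vertex has at most one incoming edge and the root has none,
  so a walk from the root is determined backwards from its end.\<close>

lemma rooted_tree_map_edges:
  assumes f: "f \<in> parent_maps m" and r: "roots m f = {r}"
  shows "rooted_tree {1..m} r (map_edges m f)"
proof -
  let ?E = "map_edges m f"
  have le: "f v \<le> m" and nil: "reaches f {} v" for v
    using f by (auto simp: parent_maps_def)
  have rm: "r \<in> {1..m}" "f r = 0"
    using r by (auto simp: roots_def)
  have ex: "\<exists>xs. walk_from_to ?E r v xs" if "v \<in> {1..m}" for v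
    using nil[of v] that
  proof induction
    case (step v)
    show ?case
    proof (cases "f v = 0")
      case True
      hence "v = r"
        using r step.prems by (auto simp: roots_def)
      thus ?thesis
        by (intro exI[of _ "[r]"]) (simp add: walk_from_to_def)
    next
      case False
      hence "f v \<in> {1..m}" and edge: "(f v, v) \<in> ?E"
        using le[of v] step.prems by (auto simp: map_edges_def)
      then obtain xs where "walk_from_to ?E r (f v) xs"
        using step.IH by blast
      from walk_snocI[OF this edge] show ?thesis ..
    qed
  qed simp
  have unique: "xs = ys" if "walk_from_to ?E r v xs" "walk_from_to ?E r v ys" for v xs ys
    using that
  proof (induction xs arbitrary: v ys rule: rev_induct)
    case Nil
    thus ?case by (simp add: walk_from_to_def)
  next
    case (snoc a xs)
    have no_edge: "(u, r) \<notin> ?E" for u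
      using rm by (auto simp: map_edges_def)
    show ?case
      using walk_snocD[OF snoc.prems(1)]
    proof (elim disjE conjE exE)
      assume "xs @ [a] = [r]" "v = r"
      thus ?thesis
        using walk_snocD[OF snoc.prems(2)] no_edge by auto
    next
      fix u zs assume u: "xs @ [a] = zs @ [v]" "walk_from_to ?E r u zs" "(u, v) \<in> ?E"
      then obtain u' ys' where u': "ys = ys' @ [v]" "walk_from_to ?E r u' ys'" "(u', v) \<in> ?E"
        using walk_snocD[OF snoc.prems(2)] no_edge by auto
      hence "u' = u"
        using u(3) by (simp add: map_edges_def)
      thus ?thesis
        using u u' snoc.IH[of u ys'] by auto
    qed
  qed
  have "?E \<subseteq> {1..m} \<times> {1..m}"
    using le by (auto simp: map_edges_def Suc_le_eq)
  moreover have "\<exists>!xs. walk_from_to ?E r v xs" if "v \<in> {1..m}" for v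
    using ex[OF that] unique by (rule ex_ex1I)
  ultimately show ?thesis
    using rm(1) by (simp add: rooted_tree_def)
qed

text \<open>Two different edges into \<open>v\<close> would extend walks from the root to two different walks to \<open>v\<close>, and
  an edge into the root would give a second walk from the root to itself.\<close>

lemma rooted_tree_in_edge:
  assumes T: "rooted_tree V r E" and v: "v \<in> V"
  shows "v = r \<Longrightarrow> (u, v) \<notin> E" and "v \<noteq> r \<Longrightarrow> \<exists>!u. (u, v) \<in> E"
proof -
  have sub: "E \<subseteq> V \<times> V" and walk: "\<And>v. v \<in> V \<Longrightarrow> \<exists>!xs. walk_from_to E r v xs"
    using T by (auto simp: rooted_tree_def)
  have unique: "xs = ys" if "v \<in> V" "walk_from_to E r v xs" "walk_from_to E r v ys" for v xs ys
    using walk[OF that(1)] that(2,3) by (elim ex1E) metis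
  show "(u, v) \<notin> E" if "v = r"
  proof
    assume uv: "(u, v) \<in> E"
    then obtain xs where xs: "walk_from_to E r u xs"
      using walk[of u] sub by blast
    have "walk_from_to E r v [r]"
      using that by (simp add: walk_from_to_def)
    from unique[OF v walk_snocI[OF xs uv] this] have "xs @ [v] = [r]" .
    thus False
      using xs by (simp add: walk_from_to_def)
  qed
  show "\<exists>!u. (u, v) \<in> E" if "v \<noteq> r"
  proof (rule ex_ex1I)
    obtain xs where "walk_from_to E r v xs"
      using walk[OF v] by blast
    from walk_snocD[OF this] show "\<exists>u. (u, v) \<in> E"
      using that by blast
  next
    fix a b assume ab: "(a, v) \<in> E" "(b, v) \<in> E"
    obtain xs ys where xs: "walk_from_to E r a xs" and ys: "walk_from_to E r b ys"
      using walk[of a] walk[of b] sub ab by blast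
    have "xs @ [v] = ys @ [v]"
      using unique[OF v walk_snocI[OF xs ab(1)] walk_snocI[OF ys ab(2)]] .
    thus "a = b"
      using xs ys by (auto simp: walk_from_to_def)
  qed
qed

text \<open>Since every vertex other than the root has exactly one incoming edge, taking its source as the
  parent recovers a parent map from the tree.\<close>

lemma rooted_tree_is_map_edges:
  assumes T: "rooted_tree {1..m} r E"
  obtains f where "f \<in> parent_maps m" "roots m f = {r}" "map_edges m f = E"
proof
  have r: "r \<in> {1..m}" and sub: "E \<subseteq> {1..m} \<times> {1..m}"
    and walk: "\<And>v. v \<in> {1..m} \<Longrightarrow> \<exists>!xs. walk_from_to E r v xs"
    using T by (auto simp: rooted_tree_def)
  define f where "f = (\<lambda>v. if v \<in> {1..m} \<and> v \<noteq> r then THE u. (u, v) \<in> E else 0)"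
  have out: "f v = 0" if "v \<notin> {1..m} \<or> v = r" for v
    using that by (auto simp: f_def)
  have edge: "(f v, v) \<in> E" if "v \<in> {1..m}" "v \<noteq> r" for v
    using theI'[OF rooted_tree_in_edge(2)[OF T that]] that by (simp add: f_def)
  have mem: "f v \<in> {1..m}" if "v \<in> {1..m}" "v \<noteq> r" for v
    using edge[OF that] sub by auto
  have iff: "(u, v) \<in> E \<longleftrightarrow> v \<in> {1..m} \<and> v \<noteq> r \<and> u = f v" for u v
  proof
    assume uv: "(u, v) \<in> E"
    hence v: "v \<in> {1..m}" "v \<noteq> r"
      using sub rooted_tree_in_edge(1)[OF T r] by auto
    moreover have "u = f v"
      using rooted_tree_in_edge(2)[OF T v] uv edge[OF v] by (elim ex1E) metis
    ultimately show "v \<in> {1..m} \<and> v \<noteq> r \<and> u = f v" by simp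
  qed (use edge in auto)
  have "reaches f {} v" if "walk_from_to E r v xs" for v xs
    using that
  proof (induction xs arbitrary: v rule: rev_induct)
    case Nil
    thus ?case by (simp add: walk_from_to_def)
  next
    case (snoc a xs)
    show ?case
      using walk_snocD[OF snoc.prems]
    proof (elim disjE conjE exE)
      assume "v = r"
      thus ?thesis
        using out[of r] by (subst reaches_iff) (auto intro: reaches.zero)
    next
      fix u ys assume "xs @ [a] = ys @ [v]" "walk_from_to E r u ys" "(u, v) \<in> E"
      thus ?thesis
        using snoc.IH[of u] iff reaches.step[of v "{}" f] by auto
    qed
  qed
  note walk_reaches = this
  have "reaches f {} v" for v
  proof (cases "v \<in> {1..m}")
    case True
    then obtain xs where "walk_from_to E r v xs"
      using walk by blast
    thus ?thesis by (rule walk_reaches)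
  next
    case False
    hence "f v = 0" by (simp add: out)
    thus ?thesis by (subst reaches_iff) (simp add: reaches.zero)
  qed
  moreover have "f v \<le> m" for v
    using out[of v] mem[of v] by (cases "v \<in> {1..m} \<and> v \<noteq> r") auto
  ultimately show "f \<in> parent_maps m"
    using out unfolding parent_maps_def by blast
  have zero: "f v \<noteq> 0 \<longleftrightarrow> v \<in> {1..m} \<and> v \<noteq> r" for v
    using out[of v] mem[of v] by (cases "v \<in> {1..m} \<and> v \<noteq> r") auto
  show "roots m f = {r}"
    unfolding roots_def using zero r by blast
  show "map_edges m f = E"
  proof (rule set_eqI)
    fix e :: "nat \<times> nat"
    obtain u v where e: "e = (u, v)" by fastforce
    show "e \<in> map_edges m f \<longleftrightarrow> e \<in> E"
      unfolding e iff using zero[of v] by (auto simp: map_edges_def)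
  qed
qed

lemma card_increasing_edges_map_edges:
  "card (increasing_edges (map_edges m f)) = card (ascents m f)"
proof (rule bij_betw_same_card)
  show "bij_betw snd (increasing_edges (map_edges m f)) (ascents m f)"
    by (rule bij_betw_byWitness[where f' = "\<lambda>v. (f v, v)"])
       (auto simp: increasing_edges_def map_edges_def ascents_def)
qed

lemma inj_on_map_edges: "inj_on (map_edges m) (parent_maps m)"
proof (rule inj_onI)
  fix f g assume f: "f \<in> parent_maps m" and g: "g \<in> parent_maps m"
    and eq: "map_edges m f = map_edges m g"
  show "f = g"
  proof
    fix v
    have "u \<noteq> 0 \<and> u = f v \<longleftrightarrow> u \<noteq> 0 \<and> u = g v" if "v \<in> {1..m}" for u
      using eq that unfolding map_edges_def by (auto simp: set_eq_iff)
    thus "f v = g v"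
      using f g by (cases "v \<in> {1..m}") (metis, simp add: parent_maps_def)
  qed
qed

lemma num_inc_rooted_trees_eq:
  "num_inc_rooted_trees m (int k) = card {f \<in> tree_maps m. card (ascents m f) = k}"
proof -
  let ?F = "\<lambda>f. (THE r. roots m f = {r}, map_edges m f)"
  have "bij_betw ?F {f \<in> tree_maps m. card (ascents m f) = k}
      {(r, E). rooted_tree {1..m} r E \<and> int (card (increasing_edges E)) = int k}"
  proof (rule bij_betwI')
    fix f g assume "f \<in> {f \<in> tree_maps m. card (ascents m f) = k}"
      "g \<in> {f \<in> tree_maps m. card (ascents m f) = k}"
    thus "?F f = ?F g \<longleftrightarrow> f = g"
      using inj_on_map_edges[of m] by (auto simp: tree_maps_def inj_on_def)
  next
    fix f assume f: "f \<in> {f \<in> tree_maps m. card (ascents m f) = k}"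
    then obtain r where "roots m f = {r}"
      by (auto simp: tree_maps_def card_1_singleton_iff)
    thus "?F f \<in> {(r, E). rooted_tree {1..m} r E \<and> int (card (increasing_edges E)) = int k}"
      using f rooted_tree_map_edges[of f m r]
      by (auto simp: tree_maps_def card_increasing_edges_map_edges)
  next
    fix a assume "a \<in> {(r, E). rooted_tree {1..m} r E \<and> int (card (increasing_edges E)) = int k}"
    then obtain r E where a: "a = (r, E)" "rooted_tree {1..m} r E" "card (increasing_edges E) = k"
      by auto
    obtain f where "f \<in> parent_maps m" "roots m f = {r}" "map_edges m f = E"
      using rooted_tree_is_map_edges[OF a(2)] .
    with a show "\<exists>f\<in>{f \<in> tree_maps m. card (ascents m f) = k}. a = ?F f"
      by (intro bexI[of _ f]) (auto simp: tree_maps_def simp flip: card_increasing_edges_map_edges)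
  qed
  thus ?thesis
    unfolding num_inc_rooted_trees_def by (simp add: bij_betw_same_card)
qed

theorem num_inc_rooted_trees_generating_function:
  fixes x :: real
  assumes "m \<ge> 1" "m \<le> M"
  shows "(\<Sum>k\<le>M. real (num_inc_rooted_trees m (int k)) * x ^ k) =
    (\<Prod>j=1..<m. real j + real (m - j) * x)"
proof -
  have fin: "finite (tree_maps m)"
    by (simp add: tree_maps_def)
  have "card (ascents m f) \<le> M" for f
    using card_mono[of "{1..m}" "ascents m f"] assms(2) by (simp add: ascents_def subset_iff)
  hence "(\<Sum>f\<in>tree_maps m. x ^ card (ascents m f)) =
      (\<Sum>k\<le>M. \<Sum>f\<in>{f \<in> tree_maps m. card (ascents m f) = k}. x ^ card (ascents m f))"
    using fin by (intro sum.group[symmetric]) auto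
  also have "\<dots> = (\<Sum>k\<le>M. real (num_inc_rooted_trees m (int k)) * x ^ k)"
    by (intro sum.cong) (auto simp: num_inc_rooted_trees_eq)
  finally show ?thesis
    using tree_maps_generating_function[OF assms(1), of x] by simp
qed

section \<open>Laws of induced subgraphs\<close>

abbreviation induced :: "nat set \<Rightarrow> (nat \<times> nat) set \<Rightarrow> (nat \<times> nat) set" where
  "induced S G \<equiv> G \<inter> S \<times> S"

text \<open>If \<open>v \<in> S\<close> moves and attaches to \<open>u\<close>, the graph induced on \<open>S\<close> afterwards is obtained from the one
  induced on \<open>S - {v}\<close> before: the new edge is visible only if \<open>u\<close> lies in \<open>S\<close>.\<close>

definition attach :: "nat set \<Rightarrow> nat \<Rightarrow> nat \<Rightarrow> (nat \<times> nat) set \<Rightarrow> (nat \<times> nat) set" where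
  "attach S v u G = (if u \<in> S then insert (u, v) G else G)"

lemma induced_move:
  assumes "v \<in> S"
  shows "induced S (insert (u, v) (isolate v G)) = attach S v u (induced (S - {v}) G)"
  using assms by (auto simp: attach_def isolate_def)

lemma induced_move_outside:
  assumes "v \<notin> S"
  shows "induced S (insert (u, v) (isolate v G)) = induced S G"
  using assms by (auto simp: isolate_def)

lemma induced_attach:
  assumes "w \<in> S" "v \<in> S" "v \<noteq> w"
  shows "induced (S - {w}) (attach S v u (induced (S - {v}) G)) =
    attach (S - {w}) v u (induced (S - {v} - {w}) G)"
  using assms by (auto simp: attach_def)

text \<open>For \<open>S \<subseteq> {1..n}\<close> with \<open>card S = k\<close> this is the law of the graph that the Moran forest induces on
  \<open>S\<close>. The vertex \<open>v\<close> is the vertex of \<open>S\<close> that moved last; when it moved it chose \<open>u\<close> among all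
  the other vertices, not only those of \<open>S\<close>. Since the size of \<open>S\<close> drives the recursion, it is a separate argument.\<close>

primrec attachment_law :: "nat \<Rightarrow> nat \<Rightarrow> nat set \<Rightarrow> (nat \<times> nat) set pmf" where
  "attachment_law n 0 S = return_pmf {}"
| "attachment_law n (Suc k) S =
    pmf_of_set S \<bind> (\<lambda>v. pmf_of_set ({1..n} - {v}) \<bind>
      (\<lambda>u. map_pmf (attach S v u) (attachment_law n k (S - {v}))))"

declare attachment_law.simps(2) [simp del]

lemma finite_insert_card_Suc:
  assumes "card S = Suc k"
  shows "finite S" "S \<noteq> {}"
  using assms by (auto intro: card_ge_0_finite)

lemma others_nonempty:
  assumes "(2::nat) \<le> n"
  shows "{1..n} - {v} \<noteq> {}"
proof
  assume "{1..n} - {v} = {}"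
  hence "card {1..n} \<le> card {v}"
    by (intro card_mono) auto
  with assms show False by simp
qed

lemma set_pmf_attachment_law_Suc:
  assumes "n \<ge> 2" "card S = Suc k"
  shows "set_pmf (attachment_law n (Suc k) S) =
    (\<Union>v\<in>S. \<Union>u\<in>{1..n} - {v}. attach S v u ` set_pmf (attachment_law n k (S - {v})))"
  using finite_insert_card_Suc[OF assms(2)] others_nonempty[OF assms(1)]
  by (simp add: attachment_law.simps(2))

lemma attachment_law_SucE:
  assumes "n \<ge> 2" "card S = Suc k" "G \<in> set_pmf (attachment_law n (Suc k) S)"
  obtains v u H where "v \<in> S" "u \<in> {1..n}" "u \<noteq> v"
    "H \<in> set_pmf (attachment_law n k (S - {v}))" "G = attach S v u H"
  using assms(3) unfolding set_pmf_attachment_law_Suc[OF assms(1,2)] by blast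

lemma finite_set_pmf_attachment_law:
  assumes "n \<ge> 2"
  shows "card S = k \<Longrightarrow> finite (set_pmf (attachment_law n k S))"
proof (induction k arbitrary: S)
  case (Suc k)
  thus ?case
    using finite_insert_card_Suc[OF Suc.prems] assms
    by (subst set_pmf_attachment_law_Suc) auto
qed simp

lemma expectation_attachment_law_Suc:
  fixes h :: "(nat \<times> nat) set \<Rightarrow> real"
  assumes n: "n \<ge> 2" and S: "S \<subseteq> {1..n}" "card S = Suc k"
  shows "measure_pmf.expectation (attachment_law n (Suc k) S) h =
    (\<Sum>v\<in>S. \<Sum>u\<in>{1..n} - {v}.
      measure_pmf.expectation (attachment_law n k (S - {v})) (\<lambda>G. h (attach S v u G)))
    / (real (Suc k) * real (n - 1))"
proof -
  note fin = finite_insert_card_Suc[OF S(2)]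
  have card: "card (S - {v}) = k" if "v \<in> S" for v
    using S(2) that by simp
  have inner: "measure_pmf.expectation (pmf_of_set ({1..n} - {v}) \<bind>
      (\<lambda>u. map_pmf (attach S v u) (attachment_law n k (S - {v})))) h =
    (\<Sum>u\<in>{1..n} - {v}.
      measure_pmf.expectation (attachment_law n k (S - {v})) (\<lambda>G. h (attach S v u G)))
    / real (n - 1)" if v: "v \<in> S" for v
    using v S others_nonempty[OF n, of v] finite_set_pmf_attachment_law[OF n card[OF v]]
    by (subst pmf_expectation_bind_pmf_of_set)
       (auto simp: integral_map_pmf card_Diff_singleton divide_inverse sum_distrib_left subset_iff mult_ac)
  have "measure_pmf.expectation (attachment_law n (Suc k) S) h =
    (\<Sum>v\<in>S. measure_pmf.expectation (pmf_of_set ({1..n} - {v}) \<bind>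
      (\<lambda>u. map_pmf (attach S v u) (attachment_law n k (S - {v})))) h /\<^sub>R real (card S))"
    unfolding attachment_law.simps(2)
    using fin others_nonempty[OF n] finite_set_pmf_attachment_law[OF n card]
    by (intro pmf_expectation_bind_pmf_of_set) auto
  also have "\<dots> = (\<Sum>v\<in>S. (\<Sum>u\<in>{1..n} - {v}.
      measure_pmf.expectation (attachment_law n k (S - {v})) (\<lambda>G. h (attach S v u G)))
    / real (n - 1) / real (Suc k))"
    by (intro sum.cong refl) (simp only: inner S(2) real_scaleR_def divide_inverse mult_ac)
  finally show ?thesis
    by (simp only: divide_divide_eq_left mult.commute flip: sum_divide_distrib)
qed

lemma attachment_law_subset:
  assumes "n \<ge> 2"
  shows "card S = k \<Longrightarrow> G \<in> set_pmf (attachment_law n k S) \<Longrightarrow> G \<subseteq> S \<times> S"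
proof (induction k arbitrary: S G)
  case (Suc k)
  obtain v u H where v: "v \<in> S" and H: "H \<in> set_pmf (attachment_law n k (S - {v}))"
    and G: "G = attach S v u H"
    using attachment_law_SucE[OF assms Suc.prems] .
  have "H \<subseteq> (S - {v}) \<times> (S - {v})"
    using Suc.IH[OF _ H] Suc.prems(1) v by simp
  thus ?case
    using v by (auto simp: G attach_def split: if_splits)
qed simp

lemma attachment_law_subset_ordered_pairs:
  assumes "n \<ge> 2"
  shows "S \<subseteq> {1..n} \<Longrightarrow> card S = k \<Longrightarrow> G \<in> set_pmf (attachment_law n k S) \<Longrightarrow> G \<subseteq> ordered_pairs n"
proof (induction k arbitrary: S G)
  case (Suc k)
  obtain v u H where v: "v \<in> S" and u: "u \<in> {1..n}" "u \<noteq> v"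
    and H: "H \<in> set_pmf (attachment_law n k (S - {v}))" and G: "G = attach S v u H"
    using attachment_law_SucE[OF assms Suc.prems(2,3)] .
  have "H \<subseteq> ordered_pairs n"
    using Suc.prems(1,2) v by (intro Suc.IH[OF _ _ H]) auto
  moreover have "(u, v) \<in> ordered_pairs n"
    using Suc.prems(1) v u by (auto simp: ordered_pairs_def)
  ultimately show ?case
    by (simp add: G attach_def)
qed simp

lemma expectation_cong:
  fixes f g :: "'a \<Rightarrow> real"
  assumes "\<And>x. x \<in> set_pmf p \<Longrightarrow> f x = g x"
  shows "measure_pmf.expectation p f = measure_pmf.expectation p g"
  using assms by (intro integral_cong_AE) (auto simp: AE_measure_pmf_iff)

text \<open>The laws for different vertex sets are consistent: the restriction from \<open>S\<close> to \<open>S - {w}\<close> has the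
  law prescribed for \<open>S - {w}\<close>. If \<open>w\<close> itself moved last, restricting undoes this move. Otherwise
  the last move of \<open>v \<noteq> w\<close> commutes with the restriction and induction applies before that move. The
  two cases have probabilities \<open>1 / card S\<close> and \<open>1 - 1 / card S\<close>, and both give the required law.\<close>

lemma expectation_induced_attachment_law:
  fixes h :: "(nat \<times> nat) set \<Rightarrow> real"
  assumes n: "n \<ge> 2"
  shows "S \<subseteq> {1..n} \<Longrightarrow> card S = Suc k \<Longrightarrow> w \<in> S \<Longrightarrow>
    measure_pmf.expectation (attachment_law n (Suc k) S) (\<lambda>G. h (induced (S - {w}) G)) =
    measure_pmf.expectation (attachment_law n k (S - {w})) h"
proof (induction k arbitrary: S w h)
  case 0
  then obtain "S = {w}"
    by (auto simp: card_1_singleton_iff)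
  thus ?case by simp
next
  case (Suc k)
  note S = Suc.prems
  note fin = finite_insert_card_Suc[OF S(2)]
  let ?E = "\<lambda>k S. measure_pmf.expectation (attachment_law n k S)"
  define T where "T = S - {w}"
  have T: "T \<subseteq> {1..n}" "card T = Suc k" "finite T"
    using S fin by (auto simp: T_def)
  have w: "(\<Sum>u\<in>{1..n} - {w}. ?E (Suc k) (S - {w}) (\<lambda>G. h (induced T (attach S w u G)))) =
      real (n - 1) * ?E (Suc k) T h"
  proof -
    have "?E (Suc k) (S - {w}) (\<lambda>G. h (induced T (attach S w u G))) = ?E (Suc k) T h" for u
    proof (unfold T_def[symmetric], rule expectation_cong)
      fix G assume "G \<in> set_pmf (attachment_law n (Suc k) T)"
      hence "G \<subseteq> T \<times> T"
        using attachment_law_subset[OF n T(2)] by blast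
      hence "induced T (attach S w u G) = G"
        by (auto simp: attach_def T_def)
      thus "h (induced T (attach S w u G)) = h G" by simp
    qed
    thus ?thesis
      using S by (auto simp: card_Diff_singleton)
  qed
  have v: "?E (Suc k) (S - {v}) (\<lambda>G. h (induced T (attach S v u G))) =
      ?E k (T - {v}) (\<lambda>G. h (attach T v u G))" if v: "v \<in> T" for u v
  proof -
    have Sv: "S - {v} \<subseteq> {1..n}" "card (S - {v}) = Suc k" "w \<in> S - {v}"
      using S v by (auto simp: T_def)
    have "?E (Suc k) (S - {v}) (\<lambda>G. h (induced T (attach S v u G))) =
        ?E (Suc k) (S - {v}) (\<lambda>G. h (attach T v u (induced (S - {v} - {w}) G)))"
    proof (rule expectation_cong)
      fix G assume "G \<in> set_pmf (attachment_law n (Suc k) (S - {v}))"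
      hence "G \<subseteq> (S - {v}) \<times> (S - {v})"
        using attachment_law_subset[OF n Sv(2)] by blast
      hence "G = induced (S - {v}) G" by auto
      hence "induced T (attach S v u G) = attach T v u (induced (S - {v} - {w}) G)"
        using induced_attach[of w S v u G] S v unfolding T_def by auto
      thus "h (induced T (attach S v u G)) = h (attach T v u (induced (S - {v} - {w}) G))"
        by simp
    qed
    also have "\<dots> = ?E k (S - {v} - {w}) (\<lambda>G. h (attach T v u G))"
      by (rule Suc.IH[OF Sv])
    also have "S - {v} - {w} = T - {v}"
      by (auto simp: T_def)
    finally show ?thesis .
  qed
  have sum_T: "(\<Sum>v\<in>T. \<Sum>u\<in>{1..n} - {v}. ?E k (T - {v}) (\<lambda>G. h (attach T v u G))) =
      real (Suc k) * real (n - 1) * ?E (Suc k) T h"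
    using n expectation_attachment_law_Suc[OF n T(1,2), of h] by simp
  have "?E (Suc (Suc k)) S (\<lambda>G. h (induced T G)) * (real (Suc (Suc k)) * real (n - 1)) =
      (\<Sum>v\<in>S. \<Sum>u\<in>{1..n} - {v}. ?E (Suc k) (S - {v}) (\<lambda>G. h (induced T (attach S v u G))))"
    using n expectation_attachment_law_Suc[OF n S(1,2), of "\<lambda>G. h (induced T G)"]
    by simp
  also have "\<dots> = real (n - 1) * ?E (Suc k) T h +
      (\<Sum>v\<in>T. \<Sum>u\<in>{1..n} - {v}. ?E (Suc k) (S - {v}) (\<lambda>G. h (induced T (attach S v u G))))"
    unfolding sum.remove[OF fin(1) S(3)] w[unfolded T_def] T_def ..
  also have "\<dots> = ?E (Suc k) T h * (real (Suc (Suc k)) * real (n - 1))"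
    using v sum_T by (simp add: algebra_simps)
  finally show ?case
    using n by (simp add: T_def)
qed

section \<open>The stationary law of the Moran chain\<close>

lemma ordered_pairs_Sigma: "ordered_pairs n = (SIGMA u:{1..n}. {1..n} - {u})"
  by (auto simp: ordered_pairs_def)

lemma finite_ordered_pairs [simp]: "finite (ordered_pairs n)"
  by (simp add: ordered_pairs_Sigma)

lemma card_ordered_pairs: "card (ordered_pairs n) = n * (n - 1)"
  by (simp add: ordered_pairs_Sigma card_Diff_singleton)

lemma sum_ordered_pairs:
  "(\<Sum>(u, v)\<in>ordered_pairs n. g u v) = (\<Sum>v\<in>{1..n}. \<Sum>u\<in>{1..n} - {v}. g u v)"
proof -
  have "(\<Sum>(u, v)\<in>ordered_pairs n. g u v) = (\<Sum>(v, u)\<in>ordered_pairs n. g u v)"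
    by (rule sum.reindex_bij_witness[of _ prod.swap prod.swap]) (auto simp: ordered_pairs_def)
  thus ?thesis
    by (simp add: ordered_pairs_Sigma sum.Sigma)
qed

lemma expectation_moran_step:
  fixes h :: "(nat \<times> nat) set \<Rightarrow> real"
  assumes n: "n \<ge> 2"
  shows "measure_pmf.expectation (moran_step n G) h =
    (\<Sum>v\<in>{1..n}. \<Sum>u\<in>{1..n} - {v}. h (insert (u, v) (isolate v G))) / (real n * real (n - 1))"
proof -
  have ne: "ordered_pairs n \<noteq> {}"
    using card_ordered_pairs[of n] n by auto
  have "measure_pmf.expectation (moran_step n G) h =
      (\<Sum>e\<in>ordered_pairs n. (case e of (u, v) \<Rightarrow> h (insert (u, v) (isolate v G)))) / real (n * (n - 1))"
    using ne by (simp add: moran_step_def integral_map_pmf integral_pmf_of_set case_prod_unfold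
      card_ordered_pairs)
  thus ?thesis
    by (simp add: sum_ordered_pairs)
qed

lemma finite_set_pmf_moran_step [simp]:
  assumes "n \<ge> 2"
  shows "finite (set_pmf (moran_step n G))"
proof -
  have "ordered_pairs n \<noteq> {}"
    using card_ordered_pairs[of n] assms by auto
  thus ?thesis
    by (simp add: moran_step_def)
qed

lemma expectation_bind_moran_step:
  fixes h :: "(nat \<times> nat) set \<Rightarrow> real"
  assumes n: "n \<ge> 2" and fin: "finite (set_pmf p)"
  shows "measure_pmf.expectation (p \<bind> moran_step n) h =
    (\<Sum>v\<in>{1..n}. \<Sum>u\<in>{1..n} - {v}.
      measure_pmf.expectation p (\<lambda>G. h (insert (u, v) (isolate v G)))) / (real n * real (n - 1))"
proof -
  have E: "measure_pmf.expectation p f = (\<Sum>G\<in>set_pmf p. pmf p G * f G)" for f :: "_ \<Rightarrow> real"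
    using fin by (subst integral_measure_pmf[of "set_pmf p"]) auto
  have "measure_pmf.expectation (p \<bind> moran_step n) h =
      measure_pmf.expectation p (\<lambda>G. measure_pmf.expectation (moran_step n G) h)"
    unfolding E using n fin by (subst pmf_expectation_bind[of "set_pmf p"]) auto
  also have "\<dots> = (\<Sum>v\<in>{1..n}. \<Sum>u\<in>{1..n} - {v}.
      measure_pmf.expectation p (\<lambda>G. h (insert (u, v) (isolate v G)))) / (real n * real (n - 1))"
    unfolding expectation_moran_step[OF n]
    using fin by (simp add: integrable_measure_pmf_finite)
  finally show ?thesis .
qed

text \<open>Laws are compared through expectations of arbitrary test functions, which turns the recursion for
  \<^const>\<open>attachment_law\<close> into identities between finite sums.\<close>

lemma pmf_eq_if_expectation_eq:
  assumes "\<And>h :: 'a \<Rightarrow> real. measure_pmf.expectation p h = measure_pmf.expectation q h"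
  shows "p = q"
proof (rule pmf_eqI)
  fix x
  show "pmf p x = pmf q x"
    using assms[of "indicator {x}"] by (simp add: measure_pmf_single)
qed

text \<open>A step of the chain changes the graph induced on \<open>S\<close> only if the moving vertex lies in \<open>S\<close>, and
  then the result depends only on the graph induced on \<open>S\<close> without that vertex. Hence, for a
  stationary law, the law of the graph induced on \<open>S\<close> is an average of laws that belong to smaller
  vertex sets, and induction on the size of \<open>S\<close> determines it.\<close>

lemma stationary_induced:
  fixes h :: "(nat \<times> nat) set \<Rightarrow> real"
  assumes n: "n \<ge> 2" and p: "moran_stationary n p"
  shows "S \<subseteq> {1..n} \<Longrightarrow> card S = k \<Longrightarrow>
    measure_pmf.expectation p (\<lambda>G. h (induced S G)) = measure_pmf.expectation (attachment_law n k S) h"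
proof (induction k arbitrary: S h)
  case 0
  hence "S = {}"
    using finite_subset[of S "{1..n}"] by simp
  thus ?case by simp
next
  case (Suc k)
  note S = Suc.prems
  let ?E = "measure_pmf.expectation p"
  have fin: "finite (set_pmf p)"
    using p by (auto simp: moran_stationary_def digraphs_def intro: finite_subset[of _ "Pow (ordered_pairs n)"])
  have le: "Suc k \<le> n"
    using card_mono[OF _ S(1)] S(2) by simp
  let ?x = "?E (\<lambda>G. h (induced S G))"
  let ?y = "measure_pmf.expectation (attachment_law n (Suc k) S) h"
  have inside: "(\<Sum>v\<in>S. \<Sum>u\<in>{1..n} - {v}. ?E (\<lambda>G. h (induced S (insert (u, v) (isolate v G))))) =
      real (Suc k) * real (n - 1) * ?y"
  proof -
    have "?E (\<lambda>G. h (induced S (insert (u, v) (isolate v G)))) =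
        measure_pmf.expectation (attachment_law n k (S - {v})) (\<lambda>G. h (attach S v u G))"
      if "v \<in> S" for u v
    proof -
      have "S - {v} \<subseteq> {1..n}" "card (S - {v}) = k"
        using S that by auto
      from Suc.IH[OF this, of "\<lambda>G. h (attach S v u G)"] show ?thesis
        by (simp only: induced_move[OF that])
    qed
    thus ?thesis
      using n expectation_attachment_law_Suc[OF n S, of h] by simp
  qed
  have outside: "(\<Sum>v\<in>{1..n} - S. \<Sum>u\<in>{1..n} - {v}. ?E (\<lambda>G. h (induced S (insert (u, v) (isolate v G))))) =
      (real n - real (Suc k)) * real (n - 1) * ?x"
  proof -
    have "(\<Sum>v\<in>{1..n} - S. \<Sum>u\<in>{1..n} - {v}. ?E (\<lambda>G. h (induced S (insert (u, v) (isolate v G))))) =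
        (\<Sum>v\<in>{1..n} - S. real (n - 1) * ?x)"
    proof (rule sum.cong)
      fix v assume "v \<in> {1..n} - S"
      thus "(\<Sum>u\<in>{1..n} - {v}. ?E (\<lambda>G. h (induced S (insert (u, v) (isolate v G))))) = real (n - 1) * ?x"
        by (simp only: induced_move_outside Diff_iff not_False_eq_True) (simp add: card_Diff_singleton)
    qed simp
    thus ?thesis
      using S le finite_subset[OF S(1)] by (simp add: card_Diff_subset of_nat_diff)
  qed
  have "p = p \<bind> moran_step n"
    using p by (simp add: moran_stationary_def)
  hence "?x = measure_pmf.expectation (p \<bind> moran_step n) (\<lambda>G. h (induced S G))"
    by simp
  also have "\<dots> = (\<Sum>v\<in>{1..n}. \<Sum>u\<in>{1..n} - {v}.
      ?E (\<lambda>G. h (induced S (insert (u, v) (isolate v G))))) / (real n * real (n - 1))"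
    by (rule expectation_bind_moran_step[OF n fin])
  also have "(\<Sum>v\<in>{1..n}. \<Sum>u\<in>{1..n} - {v}. ?E (\<lambda>G. h (induced S (insert (u, v) (isolate v G))))) =
      real (n - 1) * ((real n - real (Suc k)) * ?x + real (Suc k) * ?y)"
    unfolding sum.subset_diff[OF S(1) finite_atLeastAtMost] inside outside by (simp add: algebra_simps)
  \<comment> \<open>With \<open>K = Suc k\<close>, the moves outside \<open>S\<close> reproduce \<open>?x\<close> with weight \<open>1 - K / n\<close>. They cancel
    against the left-hand side, and \<open>?x = ?y\<close> is left.\<close>
  finally have fixed_point: "?x =
    real (n - 1) * ((real n - real (Suc k)) * ?x + real (Suc k) * ?y) / (real n * real (n - 1))" .
  have "a = b" if "a = m * ((N - K) * a + K * b) / (N * m)" "m \<noteq> 0" "N \<noteq> 0" "K \<noteq> 0"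
    for a b m N K :: real
  proof -
    have "N * a = (N - K) * a + K * b"
      using that(1-3) by (simp add: nonzero_eq_divide_eq mult_ac)
    thus ?thesis
      using that(4) by (simp add: algebra_simps)
  qed
  from this[OF fixed_point] show ?case
    using n by simp
qed

text \<open>After a move of \<open>v\<close> the graph depends only on what was induced on the other vertices. By consistency
  this part follows the law for \<open>{1..n} - {v}\<close>, so that a step of the chain performs the outermost
  step of the recursion that defines the law for \<open>{1..n}\<close>.\<close>

lemma attachment_law_stationary:
  assumes n: "n \<ge> 2"
  shows "moran_stationary n (attachment_law n n {1..n})"
proof -
  let ?V = "{1..n}" and ?p = "attachment_law n n {1..n}"
  obtain k where k: "n = Suc k"
    using n by (cases n) auto
  have card: "card ?V = Suc k" using k by simp
  have fin: "finite (set_pmf ?p)"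
    using finite_set_pmf_attachment_law[OF n, of ?V] by simp
  have "?p \<bind> moran_step n = ?p"
  proof (rule pmf_eq_if_expectation_eq)
    fix h :: "(nat \<times> nat) set \<Rightarrow> real"
    have "measure_pmf.expectation ?p (\<lambda>G. h (insert (u, v) (isolate v G))) =
        measure_pmf.expectation (attachment_law n k (?V - {v})) (\<lambda>G. h (attach ?V v u G))"
      if v: "v \<in> ?V" and u: "u \<in> ?V - {v}" for u v
    proof -
      have "measure_pmf.expectation ?p (\<lambda>G. h (insert (u, v) (isolate v G))) =
          measure_pmf.expectation ?p (\<lambda>G. h (attach ?V v u (induced (?V - {v}) G)))"
      proof (rule expectation_cong)
        fix G assume "G \<in> set_pmf ?p"
        hence "G \<subseteq> ?V \<times> ?V"
          using attachment_law_subset[OF n, of ?V n] by simp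
        hence "insert (u, v) (isolate v G) = induced ?V (insert (u, v) (isolate v G))"
          using u v by (auto simp: isolate_def)
        also have "\<dots> = attach ?V v u (induced (?V - {v}) G)"
          by (rule induced_move[OF v])
        finally show "h (insert (u, v) (isolate v G)) = h (attach ?V v u (induced (?V - {v}) G))"
          by simp
      qed
      also have "\<dots> = measure_pmf.expectation (attachment_law n k (?V - {v})) (\<lambda>G. h (attach ?V v u G))"
        using expectation_induced_attachment_law[OF n subset_refl card v] k by simp
      finally show ?thesis .
    qed
    note step = this
    have "measure_pmf.expectation (?p \<bind> moran_step n) h =
      (\<Sum>v\<in>?V. \<Sum>u\<in>?V - {v}.
        measure_pmf.expectation (attachment_law n k (?V - {v})) (\<lambda>G. h (attach ?V v u G)))
      / (real n * real (n - 1))"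
      unfolding expectation_bind_moran_step[OF n fin]
      by (intro arg_cong2[where f = "(/)"] sum.cong refl step)
    also have "\<dots> = measure_pmf.expectation (attachment_law n (Suc k) ?V) h"
      using expectation_attachment_law_Suc[OF n subset_refl card, of h] k by simp
    finally show "measure_pmf.expectation (?p \<bind> moran_step n) h = measure_pmf.expectation ?p h"
      using k by simp
  qed
  moreover have "set_pmf ?p \<subseteq> digraphs n"
    using attachment_law_subset_ordered_pairs[OF n, of ?V n] by (auto simp: digraphs_def)
  ultimately show ?thesis
    by (simp add: moran_stationary_def)
qed

text \<open>The description of a stationary law on all induced graphs contains, for the whole vertex set, the
  law itself; this gives uniqueness.\<close>

theorem moran_forest_eq:
  assumes n: "n \<ge> 2"
  shows "moran_forest n = attachment_law n n {1..n}"
  unfolding moran_forest_def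
proof (rule the_equality)
  show "moran_stationary n (attachment_law n n {1..n})"
    by (rule attachment_law_stationary[OF n])
next
  fix p assume p: "moran_stationary n p"
  show "p = attachment_law n n {1..n}"
  proof (rule pmf_eq_if_expectation_eq)
    fix h :: "(nat \<times> nat) set \<Rightarrow> real"
    have "measure_pmf.expectation p h = measure_pmf.expectation p (\<lambda>G. h (induced {1..n} G))"
    proof (rule expectation_cong)
      fix G assume "G \<in> set_pmf p"
      hence "G \<subseteq> ordered_pairs n"
        using p by (auto simp: moran_stationary_def digraphs_def)
      hence "G \<subseteq> {1..n} \<times> {1..n}"
        by (auto simp: ordered_pairs_def)
      thus "h G = h (induced {1..n} G)"
        by (simp add: Int_absorb2)
    qed
    thus "measure_pmf.expectation p h = measure_pmf.expectation (attachment_law n n {1..n}) h"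
      using stationary_induced[OF n p, of "{1..n}" n h] by simp
  qed
qed

section \<open>The number of trees\<close>

lemma card_attach_attachment_law:
  assumes n: "n \<ge> 2" and S: "card S = Suc k" and v: "v \<in> S"
    and G: "G \<in> set_pmf (attachment_law n k (S - {v}))"
  shows "card (attach S v u G) = (if u \<in> S then Suc (card G) else card G)"
proof -
  have sub: "G \<subseteq> (S - {v}) \<times> (S - {v})"
    using attachment_law_subset[OF n _ G] S v by simp
  have "finite G" "(u, v) \<notin> G"
    using finite_subset[OF sub] sub finite_insert_card_Suc(1)[OF S] by auto
  thus ?thesis
    by (simp add: attach_def)
qed

lemma card_attachment_law_le:
  assumes n: "n \<ge> 2"
  shows "card S = k \<Longrightarrow> G \<in> set_pmf (attachment_law n k S) \<Longrightarrow> card G \<le> k"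
proof (induction k arbitrary: S G)
  case (Suc k)
  obtain v u H where v: "v \<in> S" and H: "H \<in> set_pmf (attachment_law n k (S - {v}))"
    and G: "G = attach S v u H"
    using attachment_law_SucE[OF n Suc.prems] .
  have "card H \<le> k"
    using Suc.IH[OF _ H] Suc.prems(1) v by simp
  thus ?case
    by (simp add: G card_attach_attachment_law[OF n Suc.prems(1) v H])
qed simp

text \<open>Among \<open>Suc k\<close> vertices, the one that moved last chose one of the \<open>k\<close> others, and so has an incoming
  edge, with probability \<open>k / (n - 1)\<close>, whatever the rest looks like. Hence the factors. The exponent
  counts the vertices of \<open>S\<close> without incoming edge, which are the roots of the trees on \<open>S\<close>.\<close>

lemma expectation_power_missing_edges:
  fixes x :: real
  assumes n: "n \<ge> 2"
  shows "S \<subseteq> {1..n} \<Longrightarrow> card S = k \<Longrightarrow>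
    measure_pmf.expectation (attachment_law n k S) (\<lambda>G. x ^ (k - card G)) =
    (\<Prod>i<k. (real i + real (n - Suc i) * x) / real (n - 1))"
proof (induction k arbitrary: S)
  case (Suc k)
  note S = Suc.prems
  define P where "P = (\<Prod>i<k. (real i + real (n - Suc i) * x) / real (n - 1))"
  have fin: "finite S"
    by (rule finite_insert_card_Suc[OF S(2)])
  have Sv: "S - {v} \<subseteq> {1..n}" "card (S - {v}) = k" if "v \<in> S" for v
    using S that by auto
  have inner: "measure_pmf.expectation (attachment_law n k (S - {v}))
      (\<lambda>G. x ^ (Suc k - card (attach S v u G))) = (if u \<in> S then P else x * P)"
    if v: "v \<in> S" for u v
  proof -
    have "measure_pmf.expectation (attachment_law n k (S - {v}))
      (\<lambda>G. x ^ (Suc k - card (attach S v u G))) =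
      measure_pmf.expectation (attachment_law n k (S - {v}))
      (\<lambda>G. (if u \<in> S then 1 else x) * x ^ (k - card G))"
      by (rule expectation_cong) (auto simp: card_attach_attachment_law[OF n S(2) v]
        Suc_diff_le[OF card_attachment_law_le[OF n Sv(2)[OF v]]])
    thus ?thesis
      using Suc.IH[OF Sv[OF v]] by (simp add: P_def)
  qed
  have sum: "(\<Sum>u\<in>{1..n} - {v}. if u \<in> S then P else x * P) =
      (real k + real (n - Suc k) * x) * P" if v: "v \<in> S" for v
  proof -
    have "(\<Sum>u\<in>S - {v}. if u \<in> S then P else x * P) = (\<Sum>u\<in>S - {v}. P)"
      by (rule sum.cong) auto
    moreover have "(\<Sum>u\<in>{1..n} - S. if u \<in> S then P else x * P) = (\<Sum>u\<in>{1..n} - S. x * P)"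
      by (rule sum.cong) auto
    moreover have "(\<Sum>u\<in>{1..n} - {v}. if u \<in> S then P else x * P) =
        (\<Sum>u\<in>S - {v}. if u \<in> S then P else x * P) + (\<Sum>u\<in>{1..n} - S. if u \<in> S then P else x * P)"
    proof -
      have "{1..n} - {v} = (S - {v}) \<union> ({1..n} - S)"
        using S v by auto
      moreover have "(S - {v}) \<inter> ({1..n} - S) = {}"
        by auto
      ultimately show ?thesis
        using fin by (simp only: sum.union_disjoint finite_Diff finite_atLeastAtMost)
    qed
    ultimately have "(\<Sum>u\<in>{1..n} - {v}. if u \<in> S then P else x * P) =
        real (card (S - {v})) * P + real (card ({1..n} - S)) * (x * P)"
      by simp
    also have "\<dots> = (real k + real (n - Suc k) * x) * P"
      unfolding Sv(2)[OF v] card_Diff_subset[OF fin S(1)] S(2) by (simp add: algebra_simps)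
    finally show ?thesis .
  qed
  have "measure_pmf.expectation (attachment_law n (Suc k) S) (\<lambda>G. x ^ (Suc k - card G)) =
      (\<Sum>v\<in>S. (real k + real (n - Suc k) * x) * P) / (real (Suc k) * real (n - 1))"
    unfolding expectation_attachment_law_Suc[OF n S]
    by (intro arg_cong2[where f = "(/)"] sum.cong refl) (simp only: inner sum)
  also have "\<dots> = (real k + real (n - Suc k) * x) / real (n - 1) * P"
    using S(2) n by simp
  finally show ?case
    by (simp only: prod.lessThan_Suc mult.commute P_def)
qed simp

text \<open>Attaching an isolated vertex \<open>v\<close> to \<open>u\<close> merges the component \<open>{v}\<close> with that of \<open>u\<close>. To see that
  nothing else changes, contract \<open>v\<close> to \<open>u\<close>: two vertices are connected in the new graph iff their
  images under the contraction \<open>c\<close> are connected in the old one. So the new components are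
  the preimages under \<open>c\<close> of the old components other than \<open>{v}\<close>.\<close>

lemma num_trees_attach_leaf:
  assumes G: "G \<subseteq> ({1..n} - {v}) \<times> ({1..n} - {v})"
    and u: "u \<in> {1..n}" and v: "v \<in> {1..n}" and uv: "u \<noteq> v"
  shows "num_trees n G = Suc (num_trees n (insert (u, v) G))"
proof -
  let ?V = "{1..n}" and ?H = "insert (u, v) G"
  let ?R = "(G \<union> G\<inverse>)\<^sup>*" and ?Q = "(?H \<union> ?H\<inverse>)\<^sup>*"
  define c where "c = (\<lambda>a. if a = v then u else a)"
  have mono: "?R \<subseteq> ?Q"
    by (intro rtrancl_mono) auto
  have to_c: "(a, c a) \<in> ?Q" "(c a, a) \<in> ?Q" for a
    by (auto simp: c_def)
  have Q_iff: "(a, b) \<in> ?Q \<longleftrightarrow> (c a, c b) \<in> ?R" for a b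
  proof
    assume "(a, b) \<in> ?Q"
    thus "(c a, c b) \<in> ?R"
    proof induction
      case (step b d)
      have "c b = c d \<or> (c b, c d) \<in> G \<union> G\<inverse>"
        using step.hyps(2) G uv by (auto simp: c_def)
      thus ?case
        using step.IH by (auto intro: rtrancl.rtrancl_into_rtrancl)
    qed simp
  next
    assume "(c a, c b) \<in> ?R"
    hence "(c a, c b) \<in> ?Q"
      using mono by blast
    thus "(a, b) \<in> ?Q"
      using to_c by (meson rtrancl_trans)
  qed
  have isolated: "(a, b) \<in> ?R \<Longrightarrow> a = v \<longleftrightarrow> b = v" for a b
    by (induction rule: rtrancl_induct) (use G in auto)
  have cV: "c a \<in> ?V - {v}" if "a \<in> ?V" for a
    using that u uv by (simp add: c_def)
  have c_id: "c a = a" if "a \<noteq> v" for a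
    using that by (simp add: c_def)
  define K where "K = (\<lambda>a. (?R \<inter> ?V \<times> ?V) `` {a})"
  have comps_G: "components_of_graph n G = insert {v} (K ` (?V - {v}))"
  proof -
    have "K v = {v}"
      using isolated v by (auto simp: K_def)
    moreover have "components_of_graph n G = K ` ?V"
      by (auto simp: components_of_graph_def quotient_def K_def)
    moreover have "?V = insert v (?V - {v})"
      using v by auto
    ultimately show ?thesis by (metis image_insert)
  qed
  have K_sub: "K a \<subseteq> ?V - {v}" if "a \<in> ?V - {v}" for a
    using that isolated[of a v] by (auto simp: K_def)
  define pull where "pull = (\<lambda>X. {a \<in> ?V. c a \<in> X})"
  have "(?Q \<inter> ?V \<times> ?V) `` {a} = pull (K (c a))" if "a \<in> ?V" for a
    using that cV[OF that] cV Q_iff[of a] by (auto simp: K_def pull_def)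
  hence "components_of_graph n ?H = (\<lambda>a. pull (K (c a))) ` ?V"
    unfolding components_of_graph_def quotient_def by auto
  also have "\<dots> = pull ` K ` c ` ?V"
    by (simp add: image_image)
  also have "c ` ?V = ?V - {v}"
    using cV c_id by (force simp: image_iff)
  finally have comps_H: "components_of_graph n ?H = pull ` K ` (?V - {v})" .
  have "inj_on pull (K ` (?V - {v}))"
  proof (rule inj_on_inverseI)
    fix X assume "X \<in> K ` (?V - {v})"
    hence "X \<subseteq> ?V - {v}"
      using K_sub by blast
    thus "pull X - {v} = X"
      by (auto simp: pull_def c_def split: if_splits)
  qed
  hence "num_trees n ?H = card (K ` (?V - {v}))"
    unfolding num_trees_def comps_H by (rule card_image)
  moreover have "{v} \<notin> K ` (?V - {v})"
    using K_sub by blast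
  ultimately show ?thesis
    unfolding num_trees_def comps_G by simp
qed

lemma num_trees_empty: "num_trees n {} = n"
proof -
  have "components_of_graph n {} = (\<lambda>v. {v}) ` {1..n}"
    by (auto simp: components_of_graph_def quotient_def)
  thus ?thesis
    by (simp add: num_trees_def card_image)
qed

text \<open>Along the recursion every new edge joins a vertex without edges to another vertex, so each edge
  lowers the number of trees by one, starting from \<open>n\<close> isolated vertices.\<close>

lemma num_trees_plus_card:
  assumes n: "n \<ge> 2"
  shows "S \<subseteq> {1..n} \<Longrightarrow> card S = k \<Longrightarrow> G \<in> set_pmf (attachment_law n k S) \<Longrightarrow>
    num_trees n G + card G = n"
proof (induction k arbitrary: S G)
  case 0
  thus ?case by (simp add: num_trees_empty)
next
  case (Suc k)
  obtain v u H where v: "v \<in> S" and u: "u \<in> {1..n}" "u \<noteq> v"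
    and H: "H \<in> set_pmf (attachment_law n k (S - {v}))" and G: "G = attach S v u H"
    using attachment_law_SucE[OF n Suc.prems(2,3)] .
  have Sv: "S - {v} \<subseteq> {1..n}" "card (S - {v}) = k"
    using Suc.prems(1,2) v by auto
  have sub: "H \<subseteq> (S - {v}) \<times> (S - {v})"
    by (rule attachment_law_subset[OF n Sv(2) H])
  have IH: "num_trees n H + card H = n"
    by (rule Suc.IH[OF Sv H])
  have "H \<subseteq> ({1..n} - {v}) \<times> ({1..n} - {v})"
    using sub Suc.prems(1) by blast
  hence "num_trees n H = Suc (num_trees n (insert (u, v) H))"
    using u v Suc.prems(1) by (intro num_trees_attach_leaf) auto
  thus ?case
    using IH by (simp add: G card_attach_attachment_law[OF n Suc.prems(2) v H]) (simp add: attach_def)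
qed

theorem num_trees_generating_function:
  fixes x :: real
  assumes n: "n \<ge> 2" and "n \<le> N"
  shows "(\<Sum>k\<le>N. measure_pmf.prob (moran_forest n) {F. num_trees n F = k} * x ^ k) =
    (\<Prod>i<n. (real i + real (n - Suc i) * x) / real (n - 1))"
proof -
  let ?p = "attachment_law n n {1..n}"
  have card: "card {1..n} = n" by simp
  have eq: "num_trees n G = n - card G" if "G \<in> set_pmf ?p" for G
    using num_trees_plus_card[OF n subset_refl card that] by simp
  have "(\<Prod>i<n. (real i + real (n - Suc i) * x) / real (n - 1)) =
      measure_pmf.expectation ?p (\<lambda>G. x ^ (n - card G))"
    using expectation_power_missing_edges[OF n subset_refl card, of x] by simp
  also have "\<dots> = measure_pmf.expectation ?p (\<lambda>G. x ^ num_trees n G)"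
    by (rule expectation_cong) (simp add: eq)
  also have "\<dots> = measure_pmf.expectation (map_pmf (num_trees n) ?p) (\<lambda>k. x ^ k)"
    by (simp add: integral_map_pmf)
  also have "\<dots> = (\<Sum>k\<le>N. x ^ k * pmf (map_pmf (num_trees n) ?p) k)"
    using eq \<open>n \<le> N\<close> by (intro integral_measure_pmf_real) auto
  also have "\<dots> = (\<Sum>k\<le>N. measure_pmf.prob (moran_forest n) {F. num_trees n F = k} * x ^ k)"
    by (simp add: moran_forest_eq[OF n] pmf_map vimage_def mult.commute)
  finally show ?thesis ..
qed

section \<open>Comparison of coefficients\<close>

theorem proposition3p3:
  fixes n k :: nat
  assumes "n \<ge> 2"
  shows "measure_pmf.prob (moran_forest n) {F. num_trees n F = k}
           = real (num_inc_rooted_trees (n - 1) (int k - 1)) / real (n - 1) ^ (n - 2)"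
proof -
  let ?a = "\<lambda>k. real (num_inc_rooted_trees (n - 1) (int k - 1)) / real (n - 1) ^ (n - 2)"
  let ?P = "\<lambda>k. measure_pmf.prob (moran_forest n) {F. num_trees n F = k}"
  obtain m where m: "n = Suc m" "m \<ge> 1"
    using assms by (cases n) auto
  \<comment> \<open>A common degree bound that also covers a \<open>k\<close> beyond the number of vertices.\<close>
  define M where "M = max m k"
  have "(\<Sum>i\<le>Suc M. ?P i * x ^ i) = (\<Sum>i\<le>Suc M. ?a i * x ^ i)" for x
  proof -
    have "(\<Sum>i\<le>Suc M. ?P i * x ^ i) = (\<Prod>i<Suc m. (real i + real (m - i) * x) / real m)"
      using num_trees_generating_function[OF assms, of "Suc M" x] m by (simp add: M_def)
    \<comment> \<open>The factor for \<open>i = 0\<close> is \<open>x\<close>, and the one for \<open>i = m\<close> is \<open>1\<close>.\<close>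
    also have "\<dots> = x * (\<Prod>j=1..<m. (real j + real (m - j) * x) / real m)"
      using m by (simp add: lessThan_atLeast0 prod.atLeast_Suc_lessThan)
    also have "\<dots> = x * (\<Prod>j=1..<m. real j + real (m - j) * x) / real m ^ (m - 1)"
      by (simp add: prod_dividef)
    also have "\<dots> = (\<Sum>i\<le>M. ?a (Suc i) * x ^ Suc i)"
      using num_inc_rooted_trees_generating_function[of m M x, symmetric] m
      by (simp add: M_def sum_distrib_left sum_divide_distrib mult_ac)
    also have "\<dots> = (\<Sum>i\<le>Suc M. ?a i * x ^ i)"
      unfolding sum.atMost_Suc_shift by (simp add: num_inc_rooted_trees_def)
    finally show ?thesis .
  qed
  hence "\<forall>i\<le>Suc M. ?P i = ?a i"
    unfolding polyfun_eq_coeffs[symmetric] by blast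
  thus ?thesis
    by (simp add: M_def)
qed

end
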